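(* Let $X$ be a Hausdorff space, let $Z$ be a Hausdorff topological vector space, let $C\subseteq Z$ be a convex and pointed cone with nonempty interior, and let $K$ be a nonempty subset of $X$. Consider mappings $f,g:K\times K\to Z$. Assume that $x_0\in K$ is such that at least one of the following conditions holds. (A1) For every fixed $y\in K$, $y\ne x_0$, there exist nets $(x_\alpha)\subseteq K$ with $\lim x_\alpha=x_0$ and $(w_\alpha)\subseteq Z\setminus(-\operatorname{int}C)$ such that $w_\alpha-f(x_\alpha,y)-g(x_0,y)\in -C$ for all $\alpha$, and the map $x\mapsto f(x,y)$ is a-upper semicontinuous at $x_0$. (A2) For every fixed $y\in K$, $y\ne x_0$, there exist nets $(y_\alpha)\subseteq K$ with $\lim y_\alpha=y$ and $(w_\alpha)\subseteq Z\setminus(-\operatorname{int}C)$ such that $w_\alpha-f(x_0,y_\alpha)-g(x_0,y)\in -C$ for all $\alpha$, and the map $z\mapsto f(x_0,z)$ is a-upper semicontinuous at $y$. (A3) For every fixed $y\in K$, $y\ne x_0$, there exist nets $(x_\alpha),(u_\alpha)\subseteq K$ with $\lim x_\alpha=x_0$, $\lim u_\alpha=x_0$ and $(w_\alpha)\subseteq Z\setminus(-\operatorname{int}C)$ such that $w_\alpha-f(x_\alpha,y)-g(u_\alpha,y)\in -C$ for all $\alpha$, and the maps $x\mapsto f(x,y)$ and $x\mapsto g(x,y)$ are a-upper semicontinuous at $x_0$. (A4) For every fixed $y\in K$, $y\ne x_0$, there exist nets $(y_\alpha),(v_\alpha)\subseteq K$ with $\lim y_\alpha=y$, $\lim v_\alpha=y$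 and $(w_\alpha)\subseteq Z\setminus(-\operatorname{int}C)$ such that $w_\alpha-f(x_0,y_\alpha)-g(x_0,v_\alpha)\in -C$ for all $\alpha$, and the maps $z\mapsto f(x_0,z)$ and $z\mapsto g(x_0,z)$ are a-upper semicontinuous at $y$. (A5) For every fixed $y\in K$, $y\ne x_0$, there exist nets $(x_\alpha),(y_\alpha)\subseteq K$ with $\lim x_\alpha=x_0$, $\lim y_\alpha=y$ and $(w_\alpha)\subseteq Z\setminus(-\operatorname{int}C)$ such that $w_\alpha-f(x_\alpha,y)-g(x_0,y_\alpha)\in -C$ for all $\alpha$, the map $x\mapsto f(x,y)$ is a-upper semicontinuous at $x_0$, and the map $z\mapsto g(x_0,z)$ is a-upper semicontinuous at $y$. Then $f(x_0,y)+g(x_0,y)\notin-\operatorname{int} C$ for all $y\in K$, $y\neq x_0$.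
   Context: Topological vector spaces are real. A set $C\subseteq Z$ is a cone if $tc\in C$ for all $c\in C$, $t\ge 0$; it is convex if $C+C=C$ and pointed if $C\cap(-C)=\{0\}$. $\operatorname{int} C$ is the topological interior. Nets carrying the same index $\alpha$ are indexed by the same directed set. A mapping $h:K\to Z$ is almost upper semicontinuous (a-upper semicontinuous, a-usc) at $x_0\in K$ if for every net $(x_\alpha)\subseteq K$ with $\lim x_\alpha=x_0$ there exists a net $(z_\alpha)\subseteq Z$ with $\lim z_\alpha=z\in Z$ such that $h(x_\alpha)-z_\alpha\in -C$ for all $\alpha$ and $h(x_0)-z\in C$. *)

theory Defs
  imports "HOL-Analysis.Analysis" "HOL-Library.Set_Algebras"
begin

class real_tvs = real_vector + topological_ab_group_add +
  assumes tendsto_scaleR_Pair: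
    "LIM p (nhds (t::real) \<times>\<^sub>F nhds x). fst p *\<^sub>R snd p :> nhds (t *\<^sub>R x)"

instance real_normed_vector < real_tvs
proof
  fix t :: real and x :: 'a
  have "(fst \<longlongrightarrow> t) (nhds t \<times>\<^sub>F nhds x)" "(snd \<longlongrightarrow> x) (nhds t \<times>\<^sub>F nhds x)"
    using filterlim_fst[of "nhds t" "nhds x"] filterlim_snd[of "nhds x" "nhds t"] by simp_all
  then show "LIM p (nhds t \<times>\<^sub>F nhds x). fst p *\<^sub>R snd p :> nhds (t *\<^sub>R x)"
    by (rule tendsto_scaleR)
qed

text \<open>
  A net is a function restricted to a directed set \<open>(D, r)\<close>, where \<open>(a, b) \<in> r\<close> means that
  \<open>b\<close> is at least \<open>a\<close>. Its limits are the limits along the filter of tails.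
\<close>

definition directed_set :: "'i set \<Rightarrow> 'i rel \<Rightarrow> bool" where
  "directed_set D r \<longleftrightarrow> D \<noteq> {} \<and> preorder_on D r \<and>
     (\<forall>a\<in>D. \<forall>b\<in>D. \<exists>c\<in>D. (a, c) \<in> r \<and> (b, c) \<in> r)"

definition net_filter :: "'i set \<Rightarrow> 'i rel \<Rightarrow> 'i filter" where
  "net_filter D r = (INF a\<in>D. principal {b \<in> D. (a, b) \<in> r})"

lemma eventually_net_filter:
  assumes "directed_set D r"
  shows "eventually P (net_filter D r) \<longleftrightarrow> (\<exists>a\<in>D. \<forall>b\<in>D. (a, b) \<in> r \<longrightarrow> P b)"
proof -
  have tr: "trans r" and ne: "D \<noteq> {}"
    and dir: "\<And>a b. a \<in> D \<Longrightarrow> b \<in> D \<Longrightarrow> \<exists>c\<in>D. (a, c) \<in> r \<and> (b, c) \<in> r"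
    using assms by (auto simp: directed_set_def preorder_on_def)
  have "eventually P (net_filter D r) \<longleftrightarrow>
      (\<exists>a\<in>D. eventually P (principal {b \<in> D. (a, b) \<in> r}))"
    unfolding net_filter_def
  proof (rule eventually_INF_base[OF ne])
    fix a b assume "a \<in> D" "b \<in> D"
    then obtain c where "c \<in> D" "(a, c) \<in> r" "(b, c) \<in> r" using dir by blast
    then show "\<exists>c\<in>D. principal {x \<in> D. (c, x) \<in> r} \<le>
        inf (principal {x \<in> D. (a, x) \<in> r}) (principal {x \<in> D. (b, x) \<in> r})"
      using transD[OF tr] by (intro bexI[of _ c]) auto
  qed
  then show ?thesis by (auto simp: eventually_principal)
qed

text \<open>
  Almost upper semicontinuity of \<open>h : K \<rightarrow> Z\<close> at \<open>x0\<close>. HOL cannot quantify over all index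
  types inside a formula, so the directed sets are taken in the type of pairs (point, set of
  points). By \<open>a_usc_all_nets\<close> below, the property then follows for nets over directed sets of
  any type, so this is no restriction.
\<close>

definition a_usc :: "'z::real_tvs set \<Rightarrow> 'x::topological_space set \<Rightarrow> ('x \<Rightarrow> 'z) \<Rightarrow> 'x \<Rightarrow> bool" where
  "a_usc C K h x0 \<longleftrightarrow>
     (\<forall>(D :: ('x \<times> 'x set) set) r x.
        directed_set D r \<and> (\<forall>a\<in>D. x a \<in> K) \<and> (x \<longlongrightarrow> x0) (net_filter D r) \<longrightarrow>
        (\<exists>z z0. (z \<longlongrightarrow> z0) (net_filter D r) \<and>
           (\<forall>a\<in>D. h (x a) - z a \<in> uminus ` C) \<and> h x0 - z0 \<in> C))"

lemma a_usc_all_nets: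
  fixes C :: "'z::real_tvs set" and K :: "'x::topological_space set"
    and D :: "'i set" and x :: "'i \<Rightarrow> 'x"
  assumes usc: "a_usc C K h x0" and D: "directed_set D r"
    and xK: "\<forall>a\<in>D. x a \<in> K" and lim: "(x \<longlongrightarrow> x0) (net_filter D r)"
  shows "\<exists>z z0. (z \<longlongrightarrow> z0) (net_filter D r) \<and>
           (\<forall>a\<in>D. h (x a) - z a \<in> uminus ` C) \<and> h x0 - z0 \<in> C"
proof -
  have tr: "trans r" and ne: "D \<noteq> {}" and rf: "\<And>a. a \<in> D \<Longrightarrow> (a, a) \<in> r"
    and dir: "\<And>a b. a \<in> D \<Longrightarrow> b \<in> D \<Longrightarrow> \<exists>c\<in>D. (a, c) \<in> r \<and> (b, c) \<in> r"
    using D by (auto simp: directed_set_def preorder_on_def refl_on_def)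
  define T where "T a = x ` {b \<in> D. (a, b) \<in> r}" for a
  have T_self: "x a \<in> T a" if "a \<in> D" for a using that rf by (auto simp: T_def)
  have T_mono: "T b \<subseteq> T a" if "(a, b) \<in> r" for a b
    using that transD[OF tr] by (auto simp: T_def)
  define E where "E = {(p, T a) | p a. a \<in> D \<and> p \<in> T a}"
  define s where "s = {(u, v). u \<in> E \<and> v \<in> E \<and> snd v \<subseteq> snd u}"
  have E: "directed_set E s"
    unfolding directed_set_def
  proof (intro conjI ballI)
    show "E \<noteq> {}" using ne T_self by (auto simp: E_def)
    show "preorder_on E s"
      by (auto simp: preorder_on_def s_def refl_on_def trans_def)
    fix u v assume u: "u \<in> E" and v: "v \<in> E"
    then obtain a b where ab: "a \<in> D" "snd u = T a" "b \<in> D" "snd v = T b"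
      by (auto simp: E_def)
    then obtain c where c: "c \<in> D" "(a, c) \<in> r" "(b, c) \<in> r" using dir by blast
    then have "(x c, T c) \<in> E" using T_self by (auto simp: E_def)
    then show "\<exists>w\<in>E. (u, w) \<in> s \<and> (v, w) \<in> s"
      using u v ab c T_mono by (intro bexI[of _ "(x c, T c)"]) (auto simp: s_def)
  qed
  have EK: "\<forall>u\<in>E. fst u \<in> K" using xK by (auto simp: E_def T_def)
  have Elim: "(fst \<longlongrightarrow> x0) (net_filter E s)"
    unfolding tendsto_def eventually_net_filter[OF E]
  proof (intro allI impI)
    fix S assume "open S" "x0 \<in> S"
    then have "eventually (\<lambda>a. x a \<in> S) (net_filter D r)"
      using lim by (auto simp: tendsto_def)
    then obtain a where a: "a \<in> D" "\<And>b. b \<in> D \<Longrightarrow> (a, b) \<in> r \<Longrightarrow> x b \<in> S"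
      by (auto simp: eventually_net_filter[OF D])
    then have TS: "T a \<subseteq> S" by (auto simp: T_def)
    have "(x a, T a) \<in> E" using a T_self by (auto simp: E_def)
    moreover have "fst v \<in> S" if "v \<in> E" "((x a, T a), v) \<in> s" for v
    proof -
      have "fst v \<in> snd v" using that(1) by (auto simp: E_def)
      moreover have "snd v \<subseteq> T a" using that(2) by (simp add: s_def)
      ultimately show ?thesis using TS by blast
    qed
    ultimately show "\<exists>u\<in>E. \<forall>v\<in>E. (u, v) \<in> s \<longrightarrow> fst v \<in> S" by blast
  qed
  obtain z z0 where z: "(z \<longlongrightarrow> z0) (net_filter E s)"
    "\<forall>u\<in>E. h (fst u) - z u \<in> uminus ` C" "h x0 - z0 \<in> C"
    using usc E EK Elim unfolding a_usc_def by blast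
  define y where "y a = z (x a, T a)" for a
  have inE: "(x a, T a) \<in> E" if "a \<in> D" for a using that T_self by (auto simp: E_def)
  have "(y \<longlongrightarrow> z0) (net_filter D r)"
    unfolding tendsto_def eventually_net_filter[OF D]
  proof (intro allI impI)
    fix S assume "open S" "z0 \<in> S"
    then have "eventually (\<lambda>u. z u \<in> S) (net_filter E s)"
      using z by (auto simp: tendsto_def)
    then obtain u where u: "u \<in> E" "\<And>v. v \<in> E \<Longrightarrow> (u, v) \<in> s \<Longrightarrow> z v \<in> S"
      by (auto simp: eventually_net_filter[OF E])
    then obtain a where a: "a \<in> D" "snd u = T a" by (auto simp: E_def)
    have "y b \<in> S" if "b \<in> D" "(a, b) \<in> r" for b
      unfolding y_def using that u a inE T_mono by (intro u(2)) (auto simp: s_def)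
    then show "\<exists>a\<in>D. \<forall>b\<in>D. (a, b) \<in> r \<longrightarrow> y b \<in> S" using a by blast
  qed
  moreover have "\<forall>a\<in>D. h (x a) - y a \<in> uminus ` C"
    using z(2) inE by (fastforce simp: y_def)
  ultimately show ?thesis using z(3) by blast
qed

end

theory Submission
  imports Defs
begin

text \<open>
  Almost upper semicontinuity replaces the values along a net by a convergent net that dominates
  them in the order of \<open>C\<close>, with a limit dominated by the value at the limit point. Since
  \<open>int C + C \<subseteq> int C\<close>, not lying in \<open>- int C\<close> passes from smaller to larger elements, and it passes
  to limits because \<open>- int C\<close> is open.
\<close>

text \<open>The translate of \<open>interior C\<close> by \<open>c\<close> is open, contains
  \<open>x + c\<close>, and lies in \<open>C + C\<close>, hence in \<open>C\<close>. It is written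
  as a preimage under subtraction of \<open>c\<close>, so that its openness is continuity of that
  map.\<close>

lemma interior_add_in_interior:
  fixes C :: "'z::topological_ab_group_add set"
  assumes convex: "C + C \<subseteq> C" and x: "x \<in> interior C" and c: "c \<in> C"
  shows "x + c \<in> interior C"
proof (rule interiorI)
  show "open ((\<lambda>y. y - c) -` interior C)"
    by (intro open_vimage open_interior continuous_intros)
  show "x + c \<in> (\<lambda>y. y - c) -` interior C"
    using x by simp
  show "(\<lambda>y. y - c) -` interior C \<subseteq> C"
  proof
    fix y assume "y \<in> (\<lambda>y. y - c) -` interior C"
    then have "y - c \<in> C" using interior_subset by blast
    then have "(y - c) + c \<in> C + C" using c by (rule set_plus_intro)
    then show "y \<in> C" using convex by auto
  qed
qed

lemma mem_uminus_image_iff: "x \<in> uminus ` A \<longleftrightarrow> - x \<in> A" for x :: "'a::group_add"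
  by force

text \<open>By reflexivity every tail contains its starting index, so no tail is empty. This is what
  turns an eventual property into an actual index.\<close>

lemma net_filter_neq_bot:
  assumes "directed_set D r"
  shows "net_filter D r \<noteq> bot"
proof
  assume "net_filter D r = bot"
  then have "eventually (\<lambda>_. False) (net_filter D r)" by simp
  then obtain a where "a \<in> D" "\<forall>b\<in>D. (a, b) \<notin> r"
    by (auto simp: eventually_net_filter[OF assms])
  moreover have "(a, a) \<in> r" if "a \<in> D" for a
    using assms that by (auto simp: directed_set_def preorder_on_def refl_on_def)
  ultimately show False by blast
qed

text \<open>Nets are total functions whose order relations are known on \<open>D\<close> only, so an
  index extracted from an eventual property must also be known to lie in \<open>D\<close>.\<close>

lemma eventually_net_filter_in:
  assumes "directed_set D r"
  shows "eventually (\<lambda>a. a \<in> D) (net_filter D r)"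
  using assms unfolding eventually_net_filter[OF assms] directed_set_def by blast

text \<open>This is what a-upper semicontinuity yields for a single net, detached from the mapping:
  \<open>p\<close> stands for the values along the net and \<open>p0\<close> for the value at the
  limit point. Terms that move along a net and terms that stay fixed then have the same
  form.\<close>

definition upper_approx :: "'z::real_tvs set \<Rightarrow> 'i set \<Rightarrow> 'i rel \<Rightarrow> ('i \<Rightarrow> 'z) \<Rightarrow> 'z \<Rightarrow> bool" where
  "upper_approx C D r p p0 \<longleftrightarrow>
     (\<exists>z z0. (z \<longlongrightarrow> z0) (net_filter D r) \<and>
        (\<forall>a\<in>D. p a - z a \<in> uminus ` C) \<and> p0 - z0 \<in> C)"

lemma upper_approx_const:
  assumes "0 \<in> C"
  shows "upper_approx C D r (\<lambda>_. p0) p0"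
  unfolding upper_approx_def
  using assms by (intro exI[of _ "\<lambda>_. p0"] exI[of _ p0]) (auto simp: mem_uminus_image_iff)

text \<open>Going through \<open>a_usc_all_nets\<close> frees the index type from the one fixed in
  \<open>a_usc\<close>.\<close>

lemma upper_approx_a_usc:
  assumes "a_usc C K h x0" "directed_set D r" "\<forall>a\<in>D. x a \<in> K" "(x \<longlongrightarrow> x0) (net_filter D r)"
  shows "upper_approx C D r (\<lambda>a. h (x a)) (h x0)"
  unfolding upper_approx_def by (rule a_usc_all_nets[OF assms])

lemma upper_approx_not_in_minus_interior:
  assumes convex: "C + C \<subseteq> C" and D: "directed_set D r"
    and w: "\<forall>a\<in>D. w a \<notin> uminus ` interior C"
    and le: "\<forall>a\<in>D. w a - p a - q a \<in> uminus ` C"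
    and p: "upper_approx C D r p p0" and q: "upper_approx C D r q q0"
  shows "p0 + q0 \<notin> uminus ` interior C"
proof
  assume neg: "p0 + q0 \<in> uminus ` interior C"
  note add = interior_add_in_interior[OF convex]
  obtain z z0 where z: "(z \<longlongrightarrow> z0) (net_filter D r)"
    "\<forall>a\<in>D. p a - z a \<in> uminus ` C" "p0 - z0 \<in> C"
    using p unfolding upper_approx_def by blast
  obtain t t0 where t: "(t \<longlongrightarrow> t0) (net_filter D r)"
    "\<forall>a\<in>D. q a - t a \<in> uminus ` C" "q0 - t0 \<in> C"
    using q unfolding upper_approx_def by blast
  \<comment> \<open>The sum telescopes to \<open>- (z0 + t0)\<close>. It starts in
    \<open>interior C\<close> and each further summand lies in \<open>C\<close>, so
    \<open>add\<close> applies once per summand.\<close>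
  have "- (p0 + q0) + (p0 - z0) + (q0 - t0) \<in> interior C"
    using neg z(3) t(3) by (intro add) (simp_all only: mem_uminus_image_iff)
  then have lim_in: "- (z0 + t0) \<in> interior C"
    by (simp add: algebra_simps)
  have "((\<lambda>a. - (z a + t a)) \<longlongrightarrow> - (z0 + t0)) (net_filter D r)"
    using z(1) t(1) by (intro tendsto_intros)
  then have "\<forall>\<^sub>F a in net_filter D r. - (z a + t a) \<in> interior C"
    by (rule topological_tendstoD[OF _ open_interior lim_in])
  then have "\<forall>\<^sub>F a in net_filter D r. a \<in> D \<and> - (z a + t a) \<in> interior C"
    using eventually_net_filter_in[OF D] by (simp add: eventually_conj_iff)
  then obtain a where a: "a \<in> D" "- (z a + t a) \<in> interior C"
    using eventually_happens'[OF net_filter_neq_bot[OF D]] by blast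
  \<comment> \<open>The same telescoping at the single index \<open>a\<close> leaves
    \<open>- w a\<close>, against the choice of \<open>w\<close>.\<close>
  have "- (z a + t a) + - (p a - z a) + - (q a - t a) + - (w a - p a - q a) \<in> interior C"
    using a z(2) t(2) le by (intro add) (simp_all only: mem_uminus_image_iff)
  then have "- w a \<in> interior C"
    by (simp add: algebra_simps)
  then show False
    using w a(1) by (simp add: mem_uminus_image_iff)
qed

theorem theorem4p3:
  fixes C :: "'z::{real_tvs, t2_space} set"
    and K :: "'x::t2_space set"
    and f g :: "'x \<Rightarrow> 'x \<Rightarrow> 'z"
    and x0 :: 'x
  assumes cone: "cone C"
    and convex: "C + C = C"
    and pointed: "C \<inter> uminus ` C = {0}"
    and int_nonempty: "interior C \<noteq> {}"
    and K_nonempty: "K \<noteq> {}"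
    and x0: "x0 \<in> K"
    and A1_to_A5:
      "(\<forall>y\<in>K. y \<noteq> x0 \<longrightarrow>
         (\<exists>(D :: 'i set) r x w. directed_set D r \<and>
            (\<forall>a\<in>D. x a \<in> K) \<and> (x \<longlongrightarrow> x0) (net_filter D r) \<and>
            (\<forall>a\<in>D. w a \<notin> uminus ` interior C) \<and>
            (\<forall>a\<in>D. w a - f (x a) y - g x0 y \<in> uminus ` C)) \<and>
         a_usc C K (\<lambda>x. f x y) x0) \<or>
       (\<forall>y\<in>K. y \<noteq> x0 \<longrightarrow>
         (\<exists>(D :: 'i set) r y' w. directed_set D r \<and>
            (\<forall>a\<in>D. y' a \<in> K) \<and> (y' \<longlongrightarrow> y) (net_filter D r) \<and>
            (\<forall>a\<in>D. w a \<notin> uminus ` interior C) \<and>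
            (\<forall>a\<in>D. w a - f x0 (y' a) - g x0 y \<in> uminus ` C)) \<and>
         a_usc C K (\<lambda>z. f x0 z) y) \<or>
       (\<forall>y\<in>K. y \<noteq> x0 \<longrightarrow>
         (\<exists>(D :: 'i set) r x u w. directed_set D r \<and>
            (\<forall>a\<in>D. x a \<in> K) \<and> (x \<longlongrightarrow> x0) (net_filter D r) \<and>
            (\<forall>a\<in>D. u a \<in> K) \<and> (u \<longlongrightarrow> x0) (net_filter D r) \<and>
            (\<forall>a\<in>D. w a \<notin> uminus ` interior C) \<and>
            (\<forall>a\<in>D. w a - f (x a) y - g (u a) y \<in> uminus ` C)) \<and>
         a_usc C K (\<lambda>x. f x y) x0 \<and> a_usc C K (\<lambda>x. g x y) x0) \<or>
       (\<forall>y\<in>K. y \<noteq> x0 \<longrightarrow>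
         (\<exists>(D :: 'i set) r y' v w. directed_set D r \<and>
            (\<forall>a\<in>D. y' a \<in> K) \<and> (y' \<longlongrightarrow> y) (net_filter D r) \<and>
            (\<forall>a\<in>D. v a \<in> K) \<and> (v \<longlongrightarrow> y) (net_filter D r) \<and>
            (\<forall>a\<in>D. w a \<notin> uminus ` interior C) \<and>
            (\<forall>a\<in>D. w a - f x0 (y' a) - g x0 (v a) \<in> uminus ` C)) \<and>
         a_usc C K (\<lambda>z. f x0 z) y \<and> a_usc C K (\<lambda>z. g x0 z) y) \<or>
       (\<forall>y\<in>K. y \<noteq> x0 \<longrightarrow>
         (\<exists>(D :: 'i set) r x y' w. directed_set D r \<and>
            (\<forall>a\<in>D. x a \<in> K) \<and> (x \<longlongrightarrow> x0) (net_filter D r) \<and>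
            (\<forall>a\<in>D. y' a \<in> K) \<and> (y' \<longlongrightarrow> y) (net_filter D r) \<and>
            (\<forall>a\<in>D. w a \<notin> uminus ` interior C) \<and>
            (\<forall>a\<in>D. w a - f (x a) y - g x0 (y' a) \<in> uminus ` C)) \<and>
         a_usc C K (\<lambda>x. f x y) x0 \<and> a_usc C K (\<lambda>z. g x0 z) y)"
  shows "\<forall>y\<in>K. y \<noteq> x0 \<longrightarrow> f x0 y + g x0 y \<notin> uminus ` interior C"
proof (intro ballI impI)
  fix y assume y: "y \<in> K" "y \<noteq> x0"
  have C0: "0 \<in> C" using pointed by blast
  note const = upper_approx_const[OF C0]
  note concl = upper_approx_not_in_minus_interior[OF equalityD1[OF convex]]
  \<comment> \<open>In all five cases \<open>p0\<close> is \<open>f x0 y\<close> and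
    \<open>q0\<close> is \<open>g x0 y\<close>; the cases differ only in which arguments of
    \<open>f\<close> and \<open>g\<close> move along a net.\<close>
  from A1_to_A5 show "f x0 y + g x0 y \<notin> uminus ` interior C"
  proof (elim disjE, goal_cases)
    case 1
    then obtain D :: "'i set" and r x w
      where D: "directed_set D r"
        and "\<forall>a\<in>D. x a \<in> K" "(x \<longlongrightarrow> x0) (net_filter D r)"
        and w: "\<forall>a\<in>D. w a \<notin> uminus ` interior C"
        and le: "\<forall>a\<in>D. w a - f (x a) y - g x0 y \<in> uminus ` C"
        and "a_usc C K (\<lambda>x. f x y) x0"
      using y by blast
    \<comment> \<open>The term \<open>g x0 y\<close> does not move, so \<open>const\<close> supplies
      its approximation and semicontinuity is called upon for \<open>f\<close> alone.\<close>
    then show ?thesis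
      by (intro concl[OF D w le _ const] upper_approx_a_usc)
  next
    case 2
    then obtain D :: "'i set" and r y' w
      where D: "directed_set D r"
        and "\<forall>a\<in>D. y' a \<in> K" "(y' \<longlongrightarrow> y) (net_filter D r)"
        and w: "\<forall>a\<in>D. w a \<notin> uminus ` interior C"
        and le: "\<forall>a\<in>D. w a - f x0 (y' a) - g x0 y \<in> uminus ` C"
        and "a_usc C K (\<lambda>z. f x0 z) y"
      using y by blast
    then show ?thesis
      by (intro concl[OF D w le _ const] upper_approx_a_usc)
  next
    case 3
    then obtain D :: "'i set" and r x u w
      where D: "directed_set D r"
        and "\<forall>a\<in>D. x a \<in> K" "(x \<longlongrightarrow> x0) (net_filter D r)"
        and "\<forall>a\<in>D. u a \<in> K" "(u \<longlongrightarrow> x0) (net_filter D r)"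
        and w: "\<forall>a\<in>D. w a \<notin> uminus ` interior C"
        and le: "\<forall>a\<in>D. w a - f (x a) y - g (u a) y \<in> uminus ` C"
        and "a_usc C K (\<lambda>x. f x y) x0" "a_usc C K (\<lambda>x. g x y) x0"
      using y by blast
    \<comment> \<open>Both nets run over the same \<open>D\<close> and \<open>r\<close>, so the
      approximations of the two terms can be added index by index.\<close>
    then show ?thesis
      by (intro concl[OF D w le] upper_approx_a_usc)
  next
    case 4
    then obtain D :: "'i set" and r y' v w
      where D: "directed_set D r"
        and "\<forall>a\<in>D. y' a \<in> K" "(y' \<longlongrightarrow> y) (net_filter D r)"
        and "\<forall>a\<in>D. v a \<in> K" "(v \<longlongrightarrow> y) (net_filter D r)"
        and w: "\<forall>a\<in>D. w a \<notin> uminus ` interior C"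
        and le: "\<forall>a\<in>D. w a - f x0 (y' a) - g x0 (v a) \<in> uminus ` C"
        and "a_usc C K (\<lambda>z. f x0 z) y" "a_usc C K (\<lambda>z. g x0 z) y"
      using y by blast
    then show ?thesis
      by (intro concl[OF D w le] upper_approx_a_usc)
  next
    case 5
    then obtain D :: "'i set" and r x y' w
      where D: "directed_set D r"
        and "\<forall>a\<in>D. x a \<in> K" "(x \<longlongrightarrow> x0) (net_filter D r)"
        and "\<forall>a\<in>D. y' a \<in> K" "(y' \<longlongrightarrow> y) (net_filter D r)"
        and w: "\<forall>a\<in>D. w a \<notin> uminus ` interior C"
        and le: "\<forall>a\<in>D. w a - f (x a) y - g x0 (y' a) \<in> uminus ` C"
        and "a_usc C K (\<lambda>x. f x y) x0" "a_usc C K (\<lambda>z. g x0 z) y"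
      using y by blast
    then show ?thesis
      by (intro concl[OF D w le] upper_approx_a_usc)
  qed
qed

end
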